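(* For all admissible $n\geq 49$ (that is, all integers $n\ge 49$ with $n\equiv 1 \pmod 8$), there exists a uniquely $2$-colourable $4$-cycle system of order $n$.
   Context: A $4$-cycle decomposition of a graph $G$ is a family of cycles of length $4$ in $G$ such that every edge of $G$ appears in exactly one of the cycles. A $4$-cycle system of order $n$ is a $4$-cycle decomposition of the complete graph $K_n$; one exists if and only if $n\equiv 1\pmod 8$, and such $n$ are called admissible. A $k$-colouring of a cycle decomposition $\mathcal{D}$ of $G$ is a map $\varphi:V(G)\to\{c_1,\ldots,c_k\}$ (not required to be surjective) such that no cycle of $\mathcal{D}$ is monochromatic, i.e. $|\varphi(V(C))|>1$ for all $C\in\mathcal{D}$. A decomposition $\mathcal{D}$ is uniquely $k$-colourable if it has a $k$-colouring $\varphi$ and for every $k$-colouring $\psi$ of $\mathcal{D}$ there is a permutation $\sigma$ of the set of colours with $\varphi=\sigma\circ\psi$ (i.e. all $k$-colourings yield the same family of colour classes). *)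

theory Defs
  imports Main "HOL-Combinatorics.Permutations"
begin

text \<open>A simple graph is a pair of a vertex set and a set of two-element subsets of it.\<close>

type_synonym 'a graph = "'a set \<times> 'a set set"

definition verts :: "'a graph \<Rightarrow> 'a set" where
  "verts G = fst G"

definition edges :: "'a graph \<Rightarrow> 'a set set" where
  "edges G = snd G"

definition complete_graph :: "nat \<Rightarrow> nat graph" where
  "complete_graph n = ({..<n}, {{u, v} | u v. u < n \<and> v < n \<and> u \<noteq> v})"

text \<open>A cycle is identified with its set of edges, so that rotations and reflections of
  \<open>(a, b, c, d)\<close> give the same cycle; its vertex set is then \<open>\<Union>C\<close>.\<close>

definition four_cycle_in :: "'a graph \<Rightarrow> 'a set set \<Rightarrow> bool" where
  "four_cycle_in G C \<longleftrightarrow>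
     (\<exists>a b c d. distinct [a, b, c, d] \<and> C = {{a, b}, {b, c}, {c, d}, {d, a}} \<and> C \<subseteq> edges G)"

text \<open>A set of cycles suffices to represent a family: a repeated cycle would cover its edges twice.\<close>

definition four_cycle_decomposition :: "'a graph \<Rightarrow> 'a set set set \<Rightarrow> bool" where
  "four_cycle_decomposition G D \<longleftrightarrow>
     (\<forall>C\<in>D. four_cycle_in G C) \<and> (\<forall>e\<in>edges G. \<exists>!C. C \<in> D \<and> e \<in> C)"

definition four_cycle_system :: "nat \<Rightarrow> nat set set set \<Rightarrow> bool" where
  "four_cycle_system n D \<longleftrightarrow> four_cycle_decomposition (complete_graph n) D"

text \<open>The colours are \<open>0, \<dots>, k - 1\<close>; the values of a colouring outside \<open>verts G\<close> are irrelevant.\<close>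

definition colouring :: "nat \<Rightarrow> 'a graph \<Rightarrow> 'a set set set \<Rightarrow> ('a \<Rightarrow> nat) \<Rightarrow> bool" where
  "colouring k G D \<phi> \<longleftrightarrow> \<phi> ` verts G \<subseteq> {..<k} \<and> (\<forall>C\<in>D. card (\<phi> ` \<Union>C) > 1)"

definition uniquely_colourable :: "nat \<Rightarrow> 'a graph \<Rightarrow> 'a set set set \<Rightarrow> bool" where
  "uniquely_colourable k G D \<longleftrightarrow>
     (\<exists>\<phi>. colouring k G D \<phi> \<and>
        (\<forall>\<psi>. colouring k G D \<psi> \<longrightarrow>
           (\<exists>\<sigma>. \<sigma> permutes {..<k} \<and> (\<forall>v\<in>verts G. \<phi> v = \<sigma> (\<psi> v)))))"

end

theory Submission
  imports Defs
begin

text \<open>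
  Split the vertices into \<open>0\<close> and \<open>k\<close> blocks of eight. A fixed 4-cycle system of order 9 is placed
  on each block together with \<open>0\<close>, and a fixed decomposition of the complete bipartite graph with
  parts of size 8 between any two blocks. The two ingredients were found by a computer search, for
  the property that any colouring of three blocks in which \<open>0\<close> has colour white is white exactly
  on the first four vertices of each block. This is a propositional fact about 24 unknowns; it
  propagates to every number of blocks \<open>k \<ge> 3\<close>.
\<close>

section \<open>Transport and union of 4-cycle decompositions\<close>

lemma decomposition_image:
  assumes D: "four_cycle_decomposition (V, E) D" and f: "inj_on f (\<Union>E)"
  shows "four_cycle_decomposition (W, (`) f ` E) ((`) ((`) f) ` D)"
proof -
  have cyc: "four_cycle_in (V, E) C" if "C \<in> D" for C
    using D that by (simp add: four_cycle_decomposition_def)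
  have sub: "C \<subseteq> E" if "C \<in> D" for C
    using cyc[OF that] by (auto simp: four_cycle_in_def edges_def)
  have cyc': "four_cycle_in (W, (`) f ` E) ((`) f ` C)" if "C \<in> D" for C
  proof -
    obtain a b c d where abcd: "distinct [a, b, c, d]" "C = {{a, b}, {b, c}, {c, d}, {d, a}}"
      using cyc[OF \<open>C \<in> D\<close>] by (auto simp: four_cycle_in_def)
    with sub[OF that] have "{a, b, c, d} \<subseteq> \<Union>E" by auto
    with abcd(1) f have "distinct [f a, f b, f c, f d]"
      by (simp add: inj_on_eq_iff)
    moreover have "(`) f ` C = {{f a, f b}, {f b, f c}, {f c, f d}, {f d, f a}}"
      using abcd(2) by simp
    moreover have "(`) f ` C \<subseteq> edges (W, (`) f ` E)"
      using image_mono[OF sub[OF that]] by (simp add: edges_def)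
    ultimately show ?thesis
      unfolding four_cycle_in_def by (intro exI conjI)
  qed
  have ex: "\<exists>!C. C \<in> (`) ((`) f) ` D \<and> f ` e \<in> C" if "e \<in> E" for e
  proof -
    have "\<exists>!C. C \<in> D \<and> e \<in> C"
      using D that by (simp add: four_cycle_decomposition_def edges_def)
    then obtain C where C: "C \<in> D" "e \<in> C" and uniq: "\<And>C'. C' \<in> D \<Longrightarrow> e \<in> C' \<Longrightarrow> C' = C"
      by blast
    have mem: "e \<in> C'" if "C' \<in> D" "f ` e \<in> (`) f ` C'" for C'
    proof -
      obtain e' where e': "e' \<in> C'" "f ` e = f ` e'" using \<open>f ` e \<in> (`) f ` C'\<close> by auto
      then have "e = e'"
        using inj_on_image_eq_iff[OF f, of e e'] sub[OF \<open>C' \<in> D\<close>] \<open>e \<in> E\<close> by blast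
      with e' show ?thesis by simp
    qed
    show ?thesis
    proof (rule ex1I)
      show "(`) f ` C \<in> (`) ((`) f) ` D \<and> f ` e \<in> (`) f ` C"
        using C by (intro conjI imageI)
      fix B assume B: "B \<in> (`) ((`) f) ` D \<and> f ` e \<in> B"
      then obtain C' where "C' \<in> D" "B = (`) f ` C'" by (elim conjE imageE)
      moreover from this B have "e \<in> C'" using mem by simp
      ultimately show "B = (`) f ` C" using uniq by simp
    qed
  qed
  show ?thesis
    unfolding four_cycle_decomposition_def edges_def snd_conv
    by (intro conjI ballI; erule imageE; simp only: cyc' ex)
qed

lemma four_cycle_in_mono:
  assumes "four_cycle_in G C" "edges G \<subseteq> edges H"
  shows "four_cycle_in H C"
proof -
  obtain a b c d where "distinct [a, b, c, d]" "C = {{a, b}, {b, c}, {c, d}, {d, a}}" "C \<subseteq> edges G"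
    using assms(1) unfolding four_cycle_in_def by (elim exE conjE)
  moreover from this(3) assms(2) have "C \<subseteq> edges H" by (rule subset_trans)
  ultimately show ?thesis
    unfolding four_cycle_in_def by (intro exI conjI)
qed

text \<open>A cycle of \<open>D t\<close> stays inside \<open>E t\<close>. Hence two cycles through
  a common edge come from the same piece, where uniqueness is known.\<close>

lemma decomposition_Union:
  assumes D: "\<And>t. t \<in> T \<Longrightarrow> four_cycle_decomposition (V t, E t) (D t)"
    and disjoint: "\<And>t t' e. t \<in> T \<Longrightarrow> t' \<in> T \<Longrightarrow> e \<in> E t \<Longrightarrow> e \<in> E t' \<Longrightarrow> t = t'"
  shows "four_cycle_decomposition (W, \<Union>t\<in>T. E t) (\<Union>t\<in>T. D t)"
proof -
  have cyc: "four_cycle_in (V t, E t) C" if "t \<in> T" "C \<in> D t" for t C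
    using D[OF that(1)] that(2) by (simp add: four_cycle_decomposition_def)
  have sub: "C \<subseteq> E t" if "t \<in> T" "C \<in> D t" for t C
    using cyc[OF that] by (auto simp: four_cycle_in_def edges_def)
  have cyc': "four_cycle_in (W, \<Union>t\<in>T. E t) C" if "t \<in> T" "C \<in> D t" for t C
    using cyc[OF that] by (rule four_cycle_in_mono) (use \<open>t \<in> T\<close> in \<open>auto simp: edges_def\<close>)
  have ex: "\<exists>!C. C \<in> (\<Union>t\<in>T. D t) \<and> e \<in> C" if "t \<in> T" "e \<in> E t" for t e
  proof -
    have "\<exists>!C. C \<in> D t \<and> e \<in> C"
      using D[OF that(1)] that(2) by (simp add: four_cycle_decomposition_def edges_def)
    then obtain C where C: "C \<in> D t" "e \<in> C" and uniq: "\<And>C'. C' \<in> D t \<Longrightarrow> e \<in> C' \<Longrightarrow> C' = C"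
      by blast
    show ?thesis
    proof (rule ex1I)
      show "C \<in> (\<Union>t\<in>T. D t) \<and> e \<in> C" using C \<open>t \<in> T\<close> by blast
      fix B assume "B \<in> (\<Union>t\<in>T. D t) \<and> e \<in> B"
      then obtain t' where t': "t' \<in> T" "B \<in> D t'" "e \<in> B" by blast
      then have "t' = t" using disjoint that sub by blast
      with t' show "B = C" using uniq by simp
    qed
  qed
  show ?thesis
    unfolding four_cycle_decomposition_def edges_def snd_conv
    by (intro conjI ballI; erule UN_E; erule cyc' ex; assumption)
qed

section \<open>Concrete decompositions of K_9 and K_{8,8}\<close>

text \<open>Edges are represented as ordered pairs \<open>(min, max)\<close>, so that disjointness and coverage of the
  two concrete decompositions can be checked by evaluation.\<close>

type_synonym quad = "nat \<times> nat \<times> nat \<times> nat"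

fun quad_cycle :: "quad \<Rightarrow> nat set set" where
  "quad_cycle (a, b, c, d) = {{a, b}, {b, c}, {c, d}, {d, a}}"

fun quad_distinct :: "quad \<Rightarrow> bool" where
  "quad_distinct (a, b, c, d) \<longleftrightarrow> distinct [a, b, c, d]"

fun quad_edges :: "quad \<Rightarrow> (nat \<times> nat) set" where
  "quad_edges (a, b, c, d) = (\<lambda>(x, y). (min x y, max x y)) ` {(a, b), (b, c), (c, d), (d, a)}"

lemma quad_cycle_eq: "quad_cycle q = (\<lambda>(x, y). {x, y}) ` quad_edges q"
proof -
  have "{min x y, max x y} = {x, y}" for x y :: nat
    by (auto simp: min_def max_def)
  then show ?thesis by (cases q) simp
qed

lemma quad_edges_ordered: "(x, y) \<in> quad_edges q \<Longrightarrow> x \<le> y"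
  by (cases q) auto

text \<open>A single 4-cycle trivially decomposes its own edge set, so the claim is an instance of
  \<open>decomposition_Union\<close>. Ordered pairs represent edges uniquely, which turns
  disjointness of pair sets into disjointness of the cycles.\<close>

lemma decomposition_quads:
  assumes distinct: "\<forall>q\<in>Q. quad_distinct q"
    and disjoint: "\<forall>q\<in>Q. \<forall>q'\<in>Q. q \<noteq> q' \<longrightarrow> quad_edges q \<inter> quad_edges q' = {}"
  shows "four_cycle_decomposition (V, (\<lambda>(x, y). {x, y}) ` (\<Union>q\<in>Q. quad_edges q)) (quad_cycle ` Q)"
proof -
  have "four_cycle_decomposition (V, \<Union>q\<in>Q. quad_cycle q) (\<Union>q\<in>Q. {quad_cycle q})"
  proof (rule decomposition_Union)
    fix q assume "q \<in> Q"
    obtain a b c d where q: "q = (a, b, c, d)" by (cases q)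
    with distinct \<open>q \<in> Q\<close> have "distinct [a, b, c, d]" by auto
    then show "four_cycle_decomposition (UNIV, quad_cycle q) {quad_cycle q}"
      unfolding four_cycle_decomposition_def four_cycle_in_def edges_def q snd_conv quad_cycle.simps
      by blast
  next
    fix q q' e assume qq: "q \<in> Q" "q' \<in> Q" and "e \<in> quad_cycle q" "e \<in> quad_cycle q'"
    then obtain x y x' y' where
      xy: "(x, y) \<in> quad_edges q" "(x', y') \<in> quad_edges q'" "{x, y} = {x', y'}"
      unfolding quad_cycle_eq by auto
    then have "(x, y) = (x', y')"
      using quad_edges_ordered[OF xy(1)] quad_edges_ordered[OF xy(2)]
      by (auto simp: doubleton_eq_iff)
    with xy show "q = q'"
      using disjoint qq by blast
  qed
  moreover have "(\<lambda>(x, y). {x, y}) ` (\<Union>q\<in>Q. quad_edges q) = (\<Union>q\<in>Q. quad_cycle q)"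
    by (simp add: quad_cycle_eq image_UN)
  ultimately show ?thesis by (simp add: UNION_singleton_eq_range)
qed

text \<open>The label 0 is the vertex shared by all blocks. Nine cycles account for the 36 edges of
  K_9, and the 16 cycles of \<open>K88_cycles\<close> for the 64 edges of K_{8,8}.\<close>

definition K9_cycles :: "quad list" where
  "K9_cycles =
    [(0, 1, 3, 8), (0, 2, 6, 3), (0, 4, 2, 5), (0, 6, 8, 7), (1, 2, 7, 4), (1, 5, 6, 7),
     (1, 6, 4, 8), (2, 3, 5, 8), (3, 4, 5, 7)]"

definition K88_cycles :: "quad list" where
  "K88_cycles =
    [(1, 9, 5, 13), (1, 10, 3, 16), (1, 11, 2, 15), (1, 12, 7, 14), (2, 9, 6, 12),
     (2, 10, 8, 14), (2, 13, 7, 16), (3, 9, 7, 11), (3, 12, 4, 14), (3, 13, 8, 15),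
     (4, 9, 8, 11), (4, 10, 7, 15), (4, 13, 6, 16), (5, 10, 6, 15), (5, 11, 6, 14),
     (5, 12, 8, 16)]"

lemma K9_distinct: "\<forall>q\<in>set K9_cycles. quad_distinct q"
  by code_simp

lemma K9_disjoint:
  "\<forall>q\<in>set K9_cycles. \<forall>q'\<in>set K9_cycles. q \<noteq> q' \<longrightarrow> quad_edges q \<inter> quad_edges q' = {}"
  by code_simp

lemma K9_edges: "(\<Union>q\<in>set K9_cycles. quad_edges q) = (SIGMA x:{0..8}. {Suc x..8})"
  by code_simp

lemma K88_distinct: "\<forall>q\<in>set K88_cycles. quad_distinct q"
  by code_simp

lemma K88_disjoint:
  "\<forall>q\<in>set K88_cycles. \<forall>q'\<in>set K88_cycles. q \<noteq> q' \<longrightarrow> quad_edges q \<inter> quad_edges q' = {}"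
  by code_simp

lemma K88_edges: "(\<Union>q\<in>set K88_cycles. quad_edges q) = {1..8} \<times> {9..16}"
  by code_simp

section \<open>The system of order 8k + 1 assembled from blocks\<close>

text \<open>The diagonal pair stands for one block together with the vertex 0, so that a single
  index set of pairs covers both ingredients.\<close>

definition local_cycles :: "nat \<Rightarrow> nat \<Rightarrow> quad list" where
  "local_cycles i j = (if i = j then K9_cycles else K88_cycles)"

definition local_edges :: "nat \<Rightarrow> nat \<Rightarrow> (nat \<times> nat) set" where
  "local_edges i j = (if i = j then SIGMA x:{0..8}. {Suc x..8} else {1..8} \<times> {9..16})"

lemma decomposition_local:
  "four_cycle_decomposition (V, (\<lambda>(x, y). {x, y}) ` local_edges i j)
     (quad_cycle ` set (local_cycles i j))"
  using decomposition_quads[OF K9_distinct K9_disjoint]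
    decomposition_quads[OF K88_distinct K88_disjoint]
  by (simp add: local_edges_def local_cycles_def K9_edges K88_edges)

text \<open>Block \<open>i\<close> consists of the vertices \<open>8 * i + 1, \<dots>, 8 * i + 8\<close>; the local labels \<open>1, \<dots>, 8\<close>
  stand for block \<open>i\<close> and \<open>9, \<dots>, 16\<close> for block \<open>j\<close>.\<close>

definition embed :: "nat \<Rightarrow> nat \<Rightarrow> nat \<Rightarrow> nat" where
  "embed i j v = (if v = 0 then 0 else if v \<le> 8 then 8 * i + v else 8 * j + (v - 8))"

definition block_pairs :: "nat \<Rightarrow> (nat \<times> nat) set" where
  "block_pairs k = {(i, j). i \<le> j \<and> j < k}"

definition system :: "nat \<Rightarrow> nat set set set" where
  "system k = (\<Union>(i, j)\<in>block_pairs k.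
     (`) ((`) (embed i j)) ` quad_cycle ` set (local_cycles i j))"

definition block_edges :: "nat \<Rightarrow> nat \<Rightarrow> nat set set" where
  "block_edges i j = (`) (embed i j) ` (\<lambda>(x, y). {x, y}) ` local_edges i j"

lemma block_index: "a \<in> {1..8} \<Longrightarrow> (8 * m + a - 1) div 8 = (m::nat)"
proof -
  assume "a \<in> {1..8}"
  then have "8 * m + a - 1 = (a - 1) + 8 * m" "a - 1 < 8" by auto
  then show ?thesis by simp
qed

text \<open>For \<open>i = j\<close> the labels 1 and 9 have the same image, so injectivity is
  claimed only on endpoints of local edges, which then lie in 0..8. For \<open>i \<noteq> j\<close>
  the two blocks are disjoint.\<close>

lemma inj_on_embed: "inj_on (embed i j) (\<Union>((\<lambda>(x, y). {x, y}) ` local_edges i j))"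
proof (cases "i = j")
  case True
  have "inj_on (embed i j) {0..8}"
    by (rule inj_onI) (simp add: embed_def split: if_splits)
  then show ?thesis
    by (rule inj_on_subset) (use True in \<open>auto simp: local_edges_def\<close>)
next
  case False
  have *: "8 * i + x \<noteq> 8 * j + (y - 8)" if "x \<in> {1..8}" "y \<in> {9..16}" for x y
    using that False block_index[of x i] block_index[of "y - 8" j] by auto
  have "inj_on (embed i j) {1..16}"
  proof (rule inj_onI)
    fix x y :: nat
    assume "x \<in> {1..16}" "y \<in> {1..16}" "embed i j x = embed i j y"
    then show "x = y"
      using *[of x y] *[of y x] by (simp add: embed_def split: if_splits)
  qed
  then show ?thesis
    by (rule inj_on_subset) (use False in \<open>auto simp: local_edges_def\<close>)
qed

text \<open>The blocks can be read off from an edge, which will show that different pairs share no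
  edge. The vertex 0 is removed because it belongs to no block.\<close>

lemma block_edges_blocks:
  assumes "e \<in> block_edges i j"
  shows "(\<lambda>v. (v - 1) div 8) ` (e - {0}) = {i, j}"
proof -
  obtain x y where xy: "(x, y) \<in> local_edges i j" and e: "e = {embed i j x, embed i j y}"
    using assms by (auto simp: block_edges_def)
  show ?thesis
  proof (cases "i = j")
    case True
    with xy have "y \<in> {1..8}" "x \<in> {0..8}" by (auto simp: local_edges_def)
    with True e block_index[of y i] block_index[of x i] show ?thesis
      by (cases "x = 0") (auto simp: embed_def)
  next
    case False
    with xy have "x \<in> {1..8}" "y - 8 \<in> {1..8}" "y > 8" by (auto simp: local_edges_def)
    with e block_index[of x i] block_index[of "y - 8" j] show ?thesis
      by (auto simp: embed_def)
  qed
qed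

lemma complete_graph_blocks:
  "edges (complete_graph (8 * k + 1)) = (\<Union>(i, j)\<in>block_pairs k. block_edges i j)"
proof (intro equalityI subsetI)
  fix e assume "e \<in> edges (complete_graph (8 * k + 1))"
  then obtain u v where e: "e = {u, v}" and uv: "u < v" "v < 8 * k + 1"
    unfolding complete_graph_def edges_def
    by simp (metis doubleton_eq_iff linorder_neqE_nat)
  \<comment> \<open>Blocks start at 1, hence the shift by one before division and the remainder in
    1..8.\<close>
  define j y where "j = (v - 1) div 8" and "y = (v - 1) mod 8 + 1"
  have v: "v = 8 * j + y" "1 \<le> y" "y \<le> 8" "j < k"
    using uv by (auto simp: j_def y_def)
  show "e \<in> (\<Union>(i, j)\<in>block_pairs k. block_edges i j)"
  proof (cases "u = 0")
    case True
    with v e have "e = embed j j ` {0, y}" by (auto simp: embed_def)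
    moreover have "(0, y) \<in> local_edges j j" using v by (auto simp: local_edges_def)
    ultimately have "e \<in> block_edges j j" unfolding block_edges_def by blast
    with v show ?thesis by (auto simp: block_pairs_def)
  next
    case False
    define i x where "i = (u - 1) div 8" and "x = (u - 1) mod 8 + 1"
    have u: "u = 8 * i + x" "1 \<le> x" "x \<le> 8"
      using False by (auto simp: i_def x_def)
    have "i \<le> j" using uv by (auto simp: i_def j_def intro: div_le_mono)
    \<comment> \<open>The larger endpoint takes a label in 9..16 exactly when it lies in a different
      block.\<close>
    define z where "z = (if i = j then y else y + 8)"
    have "e = embed i j ` {x, z}" using u v e by (auto simp: embed_def z_def)
    moreover have "(x, z) \<in> local_edges i j"
      using u v uv by (auto simp: local_edges_def z_def)
    ultimately have "e \<in> block_edges i j" unfolding block_edges_def by blast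
    with v \<open>i \<le> j\<close> show ?thesis by (auto simp: block_pairs_def)
  qed
next
  fix e assume "e \<in> (\<Union>(i, j)\<in>block_pairs k. block_edges i j)"
  then obtain i j x y where ij: "i \<le> j" "j < k" and xy: "(x, y) \<in> local_edges i j"
    and e: "e = {embed i j x, embed i j y}"
    by (auto simp: block_edges_def block_pairs_def)
  have "x \<in> \<Union>((\<lambda>(x, y). {x, y}) ` local_edges i j)" "y \<in> \<Union>((\<lambda>(x, y). {x, y}) ` local_edges i j)"
    using xy by auto
  moreover have "x \<noteq> y" using xy by (auto simp: local_edges_def split: if_splits)
  ultimately have "embed i j x \<noteq> embed i j y" using inj_on_embed by (auto dest: inj_onD)
  moreover have "embed i j x < 8 * k + 1" "embed i j y < 8 * k + 1"
    using xy ij by (auto simp: local_edges_def embed_def split: if_splits)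
  ultimately show "e \<in> edges (complete_graph (8 * k + 1))"
    unfolding e complete_graph_def edges_def by auto
qed

lemma four_cycle_system_system: "four_cycle_system (8 * k + 1) (system k)"
proof -
  let ?D = "\<lambda>(i, j). (`) ((`) (embed i j)) ` quad_cycle ` set (local_cycles i j)"
  let ?E = "\<lambda>(i, j). block_edges i j"
  have "four_cycle_decomposition ({..<8 * k + 1}, \<Union>t\<in>block_pairs k. ?E t) (\<Union>t\<in>block_pairs k. ?D t)"
  proof (rule decomposition_Union)
    show "four_cycle_decomposition (UNIV, ?E t) (?D t)" for t
      unfolding block_edges_def
      using decomposition_image[OF decomposition_local inj_on_embed] by (cases t) simp
    fix t t' e
    assume "t \<in> block_pairs k" "t' \<in> block_pairs k" "e \<in> ?E t" "e \<in> ?E t'"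
    \<comment> \<open>Both pairs have the same underlying set of blocks, and an ordered pair with
      \<open>i \<le> j\<close> is determined by that set.\<close>
    then show "t = t'"
      using block_edges_blocks by (cases t; cases t') (fastforce simp: block_pairs_def doubleton_eq_iff)
  qed
  moreover have "complete_graph (8 * k + 1) = ({..<8 * k + 1}, \<Union>t\<in>block_pairs k. ?E t)"
    using complete_graph_blocks[of k] by (simp add: complete_graph_def edges_def)
  ultimately show ?thesis
    by (simp add: four_cycle_system_def system_def)
qed

section \<open>Two-colourings as propositional constraints\<close>

fun mixed :: "(nat \<Rightarrow> bool) \<Rightarrow> quad \<Rightarrow> bool" where
  "mixed p (a, b, c, d) \<longleftrightarrow> (p a \<or> p b \<or> p c \<or> p d) \<and> \<not> (p a \<and> p b \<and> p c \<and> p d)"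

text \<open>With two colours, knowing whether a vertex differs from the reference colour
  \<open>w\<close> determines its colour, so one Boolean per vertex suffices.\<close>

lemma card_image_quad_gt_1_iff:
  assumes "h ` {a, b, c, d} \<subseteq> {..<2::nat}" "w < 2"
  shows "card (h ` {a, b, c, d}) > 1 \<longleftrightarrow> mixed (\<lambda>v. h v \<noteq> w) (a, b, c, d)"
proof -
  have "\<not> card (h ` {a, b, c, d}) > 1 \<longleftrightarrow> h a = h b \<and> h a = h c \<and> h a = h d"
    unfolding not_less One_nat_def by (subst card_le_Suc0_iff_eq) auto
  moreover have "mixed (\<lambda>v. h v \<noteq> w) (a, b, c, d) \<longleftrightarrow> \<not> (h a = h b \<and> h a = h c \<and> h a = h d)"
  proof -
    have "h a = 0 \<or> h a = 1" "h b = 0 \<or> h b = 1" "h c = 0 \<or> h c = 1" "h d = 0 \<or> h d = 1"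
      "w = 0 \<or> w = 1"
      using assms by (simp_all add: less_2_cases_iff)
    then show ?thesis by (elim disjE) simp_all
  qed
  ultimately show ?thesis by blast
qed

definition good :: "(nat \<Rightarrow> bool) \<Rightarrow> nat \<Rightarrow> nat \<Rightarrow> bool" where
  "good p i j \<longleftrightarrow> list_all (mixed (\<lambda>v. p (embed i j v))) (local_cycles i j)"

text \<open>Choosing the colour of 0 as reference removes the symmetry that swaps the two
  colours.\<close>

lemma colouring_system_iff:
  assumes "\<psi> ` {..<8 * k + 1} \<subseteq> {..<2}"
  shows "colouring 2 (complete_graph (8 * k + 1)) (system k) \<psi> \<longleftrightarrow>
    (\<forall>(i, j)\<in>block_pairs k. good (\<lambda>v. \<psi> v \<noteq> \<psi> 0) i j)"
proof -
  have "(card (\<psi> ` \<Union>((`) (embed i j) ` quad_cycle q)) > 1) =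
      mixed (\<lambda>v. \<psi> (embed i j v) \<noteq> \<psi> 0) q"
    if ij: "(i, j) \<in> block_pairs k" and q: "q \<in> set (local_cycles i j)" for i j q
  proof -
    obtain a b c d where abcd: "q = (a, b, c, d)" by (cases q)
    \<comment> \<open>The range assumption on \<open>\<psi>\<close> speaks only of vertices of the
      graph, so the cycle must be located there first.\<close>
    have "\<Union>((`) (embed i j) ` quad_cycle q) \<subseteq> {..<8 * k + 1}"
    proof -
      have "(`) (embed i j) ` quad_cycle q \<in> system k"
        unfolding system_def using q by (intro UN_I[OF ij]) simp
      then have "four_cycle_in (complete_graph (8 * k + 1)) ((`) (embed i j) ` quad_cycle q)"
        using four_cycle_system_system[of k]
        unfolding four_cycle_system_def four_cycle_decomposition_def by (elim conjE) (rule bspec)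
      then have "(`) (embed i j) ` quad_cycle q \<subseteq> edges (complete_graph (8 * k + 1))"
        unfolding four_cycle_in_def by (elim exE conjE)
      moreover have "\<Union>(edges (complete_graph (8 * k + 1))) \<subseteq> {..<8 * k + 1}"
        by (auto simp: complete_graph_def edges_def)
      ultimately show ?thesis by (meson Union_mono subset_trans)
    qed
    moreover have un: "\<Union>((`) (embed i j) ` quad_cycle q) = embed i j ` {a, b, c, d}"
      by (auto simp: abcd)
    ultimately have "(\<psi> \<circ> embed i j) ` {a, b, c, d} \<subseteq> {..<2}"
      using assms by (fastforce simp: image_comp[symmetric])
    moreover have "\<psi> 0 < 2" using assms by auto
    ultimately show ?thesis
      using card_image_quad_gt_1_iff[of "\<psi> \<circ> embed i j" a b c d "\<psi> 0"]
      unfolding un by (simp add: abcd image_comp[symmetric])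
  qed
  then have "(\<forall>C\<in>system k. card (\<psi> ` \<Union>C) > 1) \<longleftrightarrow>
      (\<forall>(i, j)\<in>block_pairs k. good (\<lambda>v. \<psi> v \<noteq> \<psi> 0) i j)"
    by (simp add: system_def good_def list_all_iff split_beta)
  then show ?thesis
    using assms by (simp add: colouring_def verts_def complete_graph_def)
qed

section \<open>The intended colouring\<close>

definition planted :: "nat \<Rightarrow> nat" where
  "planted v = (if v \<noteq> 0 \<and> 4 \<le> (v - 1) mod 8 then 1 else 0)"

lemma planted_block: "a \<in> {1..8} \<Longrightarrow> planted (8 * i + a) = (if a > 4 then 1 else 0)"
proof -
  assume a: "a \<in> {1..8}"
  then have "8 * i + a - 1 = (a - 1) + 8 * i" "a - 1 < 8" by auto
  then have "(8 * i + a - 1) mod 8 = a - 1" by simp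
  with a show ?thesis by (auto simp: planted_def)
qed

text \<open>The colour depends only on the local label, not on the blocks: labels 5..8 and 13..16
  get colour 1. It remains to inspect the cycles of the two ingredients.\<close>

lemma good_planted: "good (\<lambda>v. planted v \<noteq> planted 0) i j"
proof -
  have *: "planted (embed i j v) = planted 0 \<longleftrightarrow> v \<notin> {5..8} \<union> {13..16}" if "v \<le> 16" for i j v
  proof (cases "v \<le> 8")
    case True
    with planted_block[of v i] show ?thesis
      by (cases "v = 0") (auto simp: embed_def planted_def[of 0])
  next
    case False
    with that have "v - 8 \<in> {1..8}" by auto
    from planted_block[OF this, of j] False that show ?thesis
      by (auto simp: embed_def planted_def[of 0])
  qed
  show ?thesis
    by (simp add: * good_def local_cycles_def K9_cycles_def K88_cycles_def)
qed

section \<open>Uniqueness: from three blocks to all blocks\<close>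

text \<open>Patterns on two blocks become one predicate on local labels. The vertex 0 gets
  \<open>False\<close> because truth means having a colour other than that of 0. Since
  \<open>K9_cycles\<close> uses labels up to 8, \<open>join s s\<close> describes one block with
  0.\<close>

definition join :: "(nat \<Rightarrow> bool) \<Rightarrow> (nat \<Rightarrow> bool) \<Rightarrow> nat \<Rightarrow> bool" where
  "join s t v = (if v = 0 then False else if v \<le> 8 then s v else t (v - 8))"

lemma join_simps:
  "join s t 0 = False" "join s t 1 = s 1" "join s t 2 = s 2" "join s t 3 = s 3" "join s t 4 = s 4"
  "join s t 5 = s 5" "join s t 6 = s 6" "join s t 7 = s 7" "join s t 8 = s 8" "join s t 9 = t 1"
  "join s t 10 = t 2" "join s t 11 = t 3" "join s t 12 = t 4" "join s t 13 = t 5"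
  "join s t 14 = t 6" "join s t 15 = t 7" "join s t 16 = t 8"
  by (simp_all add: join_def)

lemma three_patterns:
  assumes "list_all (mixed (join s s)) K9_cycles" "list_all (mixed (join t t)) K9_cycles"
    "list_all (mixed (join u u)) K9_cycles"
    and "list_all (mixed (join s t)) K88_cycles" "list_all (mixed (join s u)) K88_cycles"
    "list_all (mixed (join t u)) K88_cycles"
  shows "(\<not> s 1 \<and> \<not> s 2 \<and> \<not> s 3 \<and> \<not> s 4 \<and> s 5 \<and> s 6 \<and> s 7 \<and> s 8) \<and>
    (\<not> t 1 \<and> \<not> t 2 \<and> \<not> t 3 \<and> \<not> t 4 \<and> t 5 \<and> t 6 \<and> t 7 \<and> t 8) \<and>
    (\<not> u 1 \<and> \<not> u 2 \<and> \<not> u 3 \<and> \<not> u 4 \<and> u 5 \<and> u 6 \<and> u 7 \<and> u 8)"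
  using assms
  \<comment> \<open>Evaluating \<open>join\<close> at numerals leaves a formula in the 24 atoms
    \<open>s 1\<close>, ..., \<open>u 8\<close>, with constraints from 3 * 9 + 3 * 16 = 75 cycles,
    which the SAT solver settles.\<close>
  by (simp only: K9_cycles_def K88_cycles_def list.pred_inject mixed.simps join_simps simp_thms) sat

text \<open>The order of the indices matters: \<open>good p i j\<close> assigns labels 1..8 to the
  first block and 9..16 to the second, matching the orientation of
  \<open>block_pairs\<close>.\<close>

lemma three_blocks:
  assumes "\<not> p 0" "i < j" "j < l"
    and "good p i i" "good p j j" "good p l l" "good p i j" "good p i l" "good p j l"
  shows "\<forall>m\<in>{i, j, l}. \<forall>a\<in>{1..8}. p (8 * m + a) \<longleftrightarrow> a > 4"
proof -
  have join: "(\<lambda>v. p (embed m m' v)) = join (\<lambda>a. p (8 * m + a)) (\<lambda>a. p (8 * m' + a))" for m m'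
    using assms(1) by (simp add: fun_eq_iff join_def embed_def)
  have eight: "{1..8} = {1, 2, 3, 4, 5, 6, 7, 8::nat}" by auto
  have "i \<noteq> j" "i \<noteq> l" "j \<noteq> l" using assms(2,3) by auto
  with assms(4-9) three_patterns[of "\<lambda>a. p (8 * i + a)" "\<lambda>a. p (8 * j + a)" "\<lambda>a. p (8 * l + a)"]
  show ?thesis
    unfolding good_def join local_cycles_def eight by simp
qed

lemma good_imp_planted:
  assumes "\<not> p 0" "k \<ge> 3" and good: "\<forall>(i, j)\<in>block_pairs k. good p i j" and "v < 8 * k + 1"
  shows "p v \<longleftrightarrow> planted v \<noteq> 0"
proof (cases "v = 0")
  case True
  with assms(1) show ?thesis by (simp add: planted_def)
next
  case False
  define m a where "m = (v - 1) div 8" and "a = (v - 1) mod 8 + 1"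
  have v: "v = 8 * m + a" "a \<in> {1..8}" "m < k"
    using False assms(4) by (auto simp: m_def a_def)
  \<comment> \<open>Every block belongs to an increasing triple of blocks: 0, 1, 2 if
    \<open>m\<close> is at most 1, and 0, 1, \<open>m\<close> otherwise. This is where
    \<open>k \<ge> 3\<close> enters.\<close>
  obtain i j l where "i < j" "j < l" "l < k" "m \<in> {i, j, l}"
  proof -
    consider "m = 0" | "m = 1" | "m \<ge> 2" by linarith
    then show ?thesis
      using that[of 0 1 2] that[of 0 1 m] \<open>m < k\<close> \<open>k \<ge> 3\<close> by cases auto
  qed
  then have "\<forall>m\<in>{i, j, l}. \<forall>a\<in>{1..8}. p (8 * m + a) \<longleftrightarrow> a > 4"
    using assms(1) good by (intro three_blocks) (auto simp: block_pairs_def)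
  with \<open>m \<in> {i, j, l}\<close> v(2) have "p (8 * m + a) \<longleftrightarrow> a > 4" by blast
  with v planted_block[of a m] show ?thesis by simp
qed

lemma uniquely_colourable_system:
  assumes "k \<ge> 3"
  shows "uniquely_colourable 2 (complete_graph (8 * k + 1)) (system k)"
  unfolding uniquely_colourable_def
proof (rule exI[of _ planted], intro conjI allI impI)
  have "planted ` {..<8 * k + 1} \<subseteq> {..<2}" by (auto simp: planted_def)
  from colouring_system_iff[OF this] good_planted
  show "colouring 2 (complete_graph (8 * k + 1)) (system k) planted" by blast
  fix \<psi> assume \<psi>: "colouring 2 (complete_graph (8 * k + 1)) (system k) \<psi>"
  then have range: "\<psi> ` {..<8 * k + 1} \<subseteq> {..<2}"
    by (simp add: colouring_def verts_def complete_graph_def)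
  have "\<forall>(i, j)\<in>block_pairs k. good (\<lambda>v. \<psi> v \<noteq> \<psi> 0) i j"
    using colouring_system_iff[OF range] \<psi> by blast
  from good_imp_planted[OF _ assms this]
  have eq: "\<psi> v \<noteq> \<psi> 0 \<longleftrightarrow> planted v \<noteq> 0" if "v < 8 * k + 1" for v
    using that by blast
  \<comment> \<open>Since \<open>planted 0 = 0\<close>, the permutation must send
    \<open>\<psi> 0\<close> to 0; this transposition is the identity if \<open>\<psi> 0 = 0\<close>
    and the colour swap otherwise.\<close>
  define \<sigma> where "\<sigma> = transpose 0 (\<psi> 0)"
  have "\<psi> 0 < 2" using range by auto
  then have "\<sigma> permutes {..<2}" unfolding \<sigma>_def by (intro permutes_swap_id) auto
  moreover have "planted v = \<sigma> (\<psi> v)" if "v < 8 * k + 1" for v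
  proof -
    have "\<psi> v < 2" "planted v < 2" using that range by (auto simp: planted_def)
    with eq[OF that] \<open>\<psi> 0 < 2\<close> show ?thesis
      by (auto simp: \<sigma>_def transpose_def less_2_cases_iff)
  qed
  ultimately show "\<exists>\<sigma>. \<sigma> permutes {..<2} \<and>
      (\<forall>v\<in>verts (complete_graph (8 * k + 1)). planted v = \<sigma> (\<psi> v))"
    by (auto simp: verts_def complete_graph_def)
qed

theorem theorem1p2:
  fixes n :: nat
  assumes "n \<ge> 49" and "n mod 8 = 1"
  shows "\<exists>D. four_cycle_system n D \<and> uniquely_colourable 2 (complete_graph n) D"
proof -
  define k where "k = n div 8"
  have "n = 8 * k + 1" "k \<ge> 3"
    using assms div_mult_mod_eq[of n 8] by (simp_all add: k_def)
  then show ?thesis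
    using four_cycle_system_system uniquely_colourable_system by blast
qed

end
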